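(* Let $A\in\mathbb{R}^{n\times n}$ be entrywise nonnegative and irreducible, with $A\mathbf{1}>\mathbf{0}$, and let $D=\operatorname{diag}(A\mathbf{1})$. Let $\mathbf{t}\in\mathbb{R}^n$ with $\mathbf{t}\ge\mathbf{0}$ and $\mathbf{t}^{\top}\mathbf{1}=1$, let $\alpha\in(0,1)$, and let $\widehat{\boldsymbol{\pi}}\in\mathbb{R}^n$ with $\widehat{\boldsymbol{\pi}}>\mathbf{0}$ and $\widehat{\boldsymbol{\pi}}^{\top}\mathbf{1}=1$. Let $\Delta\in\mathbb{S}(A+I)$ be a matrix such that $\Delta\mathbf{1}=\mathbf{0}$, the off-diagonal entries of $A+\Delta$ are nonnegative, and $\widetilde{G}^{\top}\widehat{\boldsymbol{\pi}}=\widehat{\boldsymbol{\pi}}$, where $\widetilde{G}=\alpha D^{-1}(A+\Delta)+(1-\alpha)\mathbf{1}\mathbf{t}^{\top}$. Define $$\theta=\min_i\,[D^{-1}(A+\Delta)]_{i,i}.$$ If $\theta\ge 0$, then $D^{-1}(A+\Delta)$ is stochastic. Otherwise, if $\theta<0$, set $\widehat r=1-\alpha\theta$; then for any $r\ge\widehat r$ we have $\widehat{G}^{\top}\widehat{\boldsymbol{\pi}}=\widehat{\boldsymbol{\pi}}$, where $$\widehat{G}=\widehat\alpha\,\widehat P+(1-\widehat\alpha)\mathbf{1}\mathbf{t}^{\top},\qquad \widehat\alpha=1-\frac{1-\alpha}{r},\qquad \widehat P=\frac{1}{r-1+\alpha}\left(\alpha D^{-1}(A+\Delta)+(r-1)I\right),$$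 and $\widehat P$ is stochastic.
   Context: Here $\mathbf{1}$ is the all-ones vector in $\mathbb{R}^n$, vector and matrix inequalities are entrywise, and $\operatorname{diag}(\mathbf{x})$ is the diagonal matrix with diagonal $\mathbf{x}$. For a matrix $M\in\mathbb{R}^{n\times n}$, $\mathbb{S}(M)$ is the set of matrices $B\in\mathbb{R}^{n\times n}$ such that $[B]_{i,j}\neq 0$ implies $[M]_{i,j}\ne 0$. Irreducible means that the directed graph with an edge from $i$ to $j$ whenever $[A]_{i,j}\ne0$ is strongly connected. A matrix $P$ is stochastic if it is entrywise nonnegative and $P\mathbf{1}=\mathbf{1}$. *)

theory Defs
  imports "HOL-Analysis.Analysis" "Graph_Theory.Digraph_Component"
begin

definition diag :: "real^'n \<Rightarrow> real^'n^'n" where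
  "diag x = (\<chi> i j. if i = j then x $ i else 0)"

text \<open>The product \<open>x y\<^sup>T\<close>. It is not written as \<open>columnvector x ** rowvector y\<close>
  because the library leaves the intermediate dimension of these two polymorphic instead of
  fixing it to \<open>1\<close>.\<close>

definition outer :: "real^'n \<Rightarrow> real^'n \<Rightarrow> real^'n^'n" where
  "outer x y = (\<chi> i j. x $ i * y $ j)"

definition supp_matrices :: "real^'n^'n \<Rightarrow> (real^'n^'n) set" where
  "supp_matrices M = {B. \<forall>i j. B $ i $ j \<noteq> 0 \<longrightarrow> M $ i $ j \<noteq> 0}"

definition matrix_digraph :: "real^'n^'n \<Rightarrow> ('n, 'n \<times> 'n) pre_digraph" where
  "matrix_digraph A = \<lparr>verts = UNIV, arcs = {(i, j). A $ i $ j \<noteq> 0}, tail = fst, head = snd\<rparr>"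

definition irreducible_matrix :: "real^'n^'n \<Rightarrow> bool" where
  "irreducible_matrix A \<longleftrightarrow> strongly_connected (matrix_digraph A)"

text \<open>Here \<open>1 :: real^'n\<close> is the all-ones vector (multiplication on \<open>real^'n\<close> is
  componentwise), while the identity matrix is \<open>mat 1\<close>. The library order \<open>\<le>\<close> on
  \<open>real^'n\<close> and \<open>real^'n^'n\<close> is entrywise, but \<open>x < y\<close> only means
  \<open>x \<le> y \<and> x \<noteq> y\<close>; strict entrywise inequalities are therefore written out.\<close>

definition stochastic :: "real^'n^'n \<Rightarrow> bool" where
  "stochastic P \<longleftrightarrow> 0 \<le> P \<and> P *v 1 = 1"

end

theory Submission
  imports Defs
begin

text \<open>Let \<open>P = D\<^sup>-\<^sup>1 (A + \<Delta>)\<close>. Since \<open>alphahat Phat = (\<alpha> P + (r - 1) I) / r\<close> and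
  \<open>1 - alphahat = (1 - \<alpha>) / r\<close>, we have \<open>Ghat = Gtilde / r + (1 - 1 / r) I\<close>, so \<open>Ghat\<close>
  inherits the fixed vectors of \<open>Gtilde\<close>. The row sums of \<open>Phat\<close> are \<open>1\<close> because those of
  \<open>P\<close> are, and the choice of \<open>rhat\<close> is exactly what makes its diagonal nonnegative.\<close>

text \<open>\<open>matrix_inv\<close> is a choice among the two-sided inverses. The matrix
  \<open>B\<close> witnesses that one exists, and multiplying
  \<open>A ** matrix_inv A = mat 1\<close> by \<open>B\<close> on the left forces the choice to be
  \<open>B\<close>.\<close>

lemma matrix_inv_unique:
  fixes A :: "'a::semiring_1^'n^'m"
  assumes AB: "A ** B = mat 1" and BA: "B ** A = mat 1"
  shows "matrix_inv A = B"
proof -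
  have "A ** matrix_inv A = mat 1"
    unfolding matrix_inv_def using someI [where x = B and P = "\<lambda>C. A ** C = mat 1 \<and> C ** A = mat 1"] assms
    by blast
  then have "B ** (A ** matrix_inv A) = B"
    by simp
  then show ?thesis
    by (simp add: matrix_mul_assoc BA)
qed

lemma matrix_inv_diag:
  fixes x :: "real^'n"
  assumes "\<forall>i. x $ i \<noteq> 0"
  shows "matrix_inv (diag x) = diag (\<chi> i. inverse (x $ i))"
proof (rule matrix_inv_unique)
  show "diag x ** diag (\<chi> i. inverse (x $ i)) = mat 1"
    "diag (\<chi> i. inverse (x $ i)) ** diag x = mat 1"
    using assms
    by (simp_all add: vec_eq_iff matrix_matrix_mult_def diag_def mat_def mult_delta_left)
qed

lemma diag_mult_nth: "(diag x ** B) $ i $ j = x $ i * B $ i $ j"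
  by (simp add: matrix_matrix_mult_def diag_def mult_delta_left)

text \<open>The identity fixes every vector, and the weights \<open>1 - c\<close> and
  \<open>c\<close> add up to 1. With \<open>c = 1 / r\<close> this carries \<open>pihat\<close> over
  from \<open>Gtilde\<close> to \<open>Ghat\<close>.\<close>

lemma transpose_convex_identity_fixed:
  fixes G :: "real^'n^'n"
  assumes "transpose G *v x = x"
  shows "transpose ((1 - c) *\<^sub>R mat 1 + c *\<^sub>R G) *v x = x"
proof -
  have "transpose ((1 - c) *\<^sub>R mat 1 + c *\<^sub>R G) = (1 - c) *\<^sub>R mat 1 + c *\<^sub>R transpose G"
    by (simp add: vec_eq_iff transpose_def mat_def)
  then show ?thesis
    using assms by (simp add: matrix_vector_mult_add_rdistrib scaleR_matrix_vector_assoc [symmetric]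
        flip: scaleR_left_distrib)
qed

text \<open>The shift by \<open>b\<close> touches only the diagonal and raises each row sum from
  \<open>a\<close> to \<open>a + b\<close>, which the leading factor normalises. Both cases of the
  theorem are instances: \<open>a = 1\<close>, \<open>b = 0\<close> for \<open>P\<close>, and
  \<open>a = \<alpha>\<close>, \<open>b = r - 1\<close> for \<open>Phat\<close>.\<close>

lemma stochastic_shifted:
  fixes P :: "real^'n^'n"
  assumes row_sums: "P *v 1 = 1"
    and off_diag: "\<And>i j. i \<noteq> j \<Longrightarrow> 0 \<le> P $ i $ j"
    and diag: "\<And>i. 0 \<le> a * P $ i $ i + b"
    and "0 \<le> a" "0 < a + b"
  shows "stochastic ((1 / (a + b)) *\<^sub>R (a *\<^sub>R P + b *\<^sub>R mat 1))"
  unfolding stochastic_def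
proof
  have "0 \<le> a * P $ i $ j + (if i = j then b else 0)" for i j
    using off_diag [of i j] diag [of i] \<open>0 \<le> a\<close> by (cases "i = j") auto
  then show "0 \<le> (1 / (a + b)) *\<^sub>R (a *\<^sub>R P + b *\<^sub>R mat 1)"
    using \<open>0 < a + b\<close> by (auto simp: less_eq_vec_def mat_def if_distrib cong: if_cong)
  have "((1 / (a + b)) *\<^sub>R (a *\<^sub>R P + b *\<^sub>R mat 1)) *v 1
      = (1 / (a + b)) *\<^sub>R ((a + b) *\<^sub>R (1 :: real^'n))"
    by (simp add: matrix_vector_mult_add_rdistrib scaleR_matrix_vector_assoc [symmetric] row_sums
        scaleR_left_distrib)
  then show "((1 / (a + b)) *\<^sub>R (a *\<^sub>R P + b *\<^sub>R mat 1)) *v 1 = 1"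
    using \<open>0 < a + b\<close> by simp
qed

theorem proposition4p4:
  fixes A D \<Delta> Gtilde :: "real^'n^'n"
    and t pihat :: "real^'n"
    and \<alpha> \<theta> :: real
  assumes A_nonneg: "0 \<le> A"
    and A_irreducible: "irreducible_matrix A"
    and A_row_sums_pos: "\<forall>i. 0 < (A *v 1) $ i"
    and D: "D = diag (A *v 1)"
    and t_nonneg: "0 \<le> t"
    and t_sum: "t \<bullet> 1 = 1"
    and alpha: "0 < \<alpha>" "\<alpha> < 1"
    and pihat_pos: "\<forall>i. 0 < pihat $ i"
    and pihat_sum: "pihat \<bullet> 1 = 1"
    and Delta_supp: "\<Delta> \<in> supp_matrices (A + mat 1)"
    and Delta_row_sums: "\<Delta> *v 1 = 0"
    and off_diag_nonneg: "\<forall>i j. i \<noteq> j \<longrightarrow> 0 \<le> (A + \<Delta>) $ i $ j"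
    and Gtilde: "Gtilde = \<alpha> *\<^sub>R (matrix_inv D ** (A + \<Delta>))
                   + (1 - \<alpha>) *\<^sub>R outer 1 t"
    and Gtilde_pihat: "transpose Gtilde *v pihat = pihat"
    and theta: "\<theta> = Min (range (\<lambda>i. (matrix_inv D ** (A + \<Delta>)) $ i $ i))"
  shows "(0 \<le> \<theta> \<longrightarrow> stochastic (matrix_inv D ** (A + \<Delta>))) \<and>
    (\<theta> < 0 \<longrightarrow>
      (let rhat = 1 - \<alpha> * \<theta> in \<forall>r \<ge> rhat.
        let alphahat = 1 - (1 - \<alpha>) / r;
            Phat = (1 / (r - 1 + \<alpha>)) *\<^sub>R
                     (\<alpha> *\<^sub>R (matrix_inv D ** (A + \<Delta>)) + (r - 1) *\<^sub>R mat 1);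
            Ghat = alphahat *\<^sub>R Phat
                     + (1 - alphahat) *\<^sub>R outer 1 t
        in transpose Ghat *v pihat = pihat \<and> stochastic Phat))"
proof -
  define P where "P = matrix_inv D ** (A + \<Delta>)"
  have D_inv: "matrix_inv D = diag (\<chi> i. inverse ((A *v 1) $ i))"
    unfolding D using A_row_sums_pos by (intro matrix_inv_diag) (metis less_irrefl)
  have P_nth: "P $ i $ j = inverse ((A *v 1) $ i) * (A + \<Delta>) $ i $ j" for i j
    by (simp add: P_def D_inv diag_mult_nth)
  \<comment> \<open>The perturbation keeps the row sums of \<open>A\<close>, and these are what
    \<open>D\<close> divides out.\<close>
  have "(A + \<Delta>) *v 1 = A *v 1"
    by (simp add: matrix_vector_mult_add_rdistrib Delta_row_sums)
  then have "P *v 1 = diag (\<chi> i. inverse ((A *v 1) $ i)) *v (A *v 1)"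
    by (simp add: P_def D_inv flip: matrix_vector_mul_assoc)
  \<comment> \<open>The instance at \<open>vec_lambda _\<close> expands only the product with the
    diagonal matrix; \<open>A *v 1\<close> stays folded, so the positivity of its entries
    applies.\<close>
  also have "\<dots> = 1"
    using A_row_sums_pos
    by (simp add: vec_eq_iff diag_def matrix_vector_mult_def [of "vec_lambda _"]
        mult_delta_left less_imp_neq [THEN not_sym])
  finally have P_row_sums: "P *v 1 = 1" .
  have P_off_diag: "0 \<le> P $ i $ j" if "i \<noteq> j" for i j
    using that off_diag_nonneg A_row_sums_pos
    unfolding P_nth by (meson inverse_nonnegative_iff_nonnegative less_imp_le mult_nonneg_nonneg)
  have theta_le: "\<theta> \<le> P $ i $ i" for i
    unfolding theta P_def by (intro Min_le) auto

  have P_stochastic: "stochastic P" if "0 \<le> \<theta>"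
    using stochastic_shifted [OF P_row_sums P_off_diag, of 1 0] order_trans [OF that theta_le]
    by simp

  have shifted: "transpose Ghat *v pihat = pihat \<and> stochastic Phat"
    if "\<theta> < 0" and r: "1 - \<alpha> * \<theta> \<le> r"
      and alphahat: "alphahat = 1 - (1 - \<alpha>) / r"
      and Phat: "Phat = (1 / (r - 1 + \<alpha>)) *\<^sub>R (\<alpha> *\<^sub>R P + (r - 1) *\<^sub>R mat 1)"
      and Ghat: "Ghat = alphahat *\<^sub>R Phat + (1 - alphahat) *\<^sub>R outer 1 t"
    for r alphahat Phat Ghat
  proof
    \<comment> \<open>A negative \<theta> puts \<open>rhat\<close> above 1, so both denominators
      \<open>r\<close> and \<open>r - 1 + \<alpha>\<close> are positive.\<close>
    have "\<alpha> * \<theta> < 0"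
      using \<open>\<theta> < 0\<close> alpha by (simp add: mult_pos_neg)
    then have "1 < r"
      using r by linarith
    \<comment> \<open>Since \<open>alphahat = (r - 1 + \<alpha>) / r\<close>, the normalising factor
      of \<open>Phat\<close> cancels.\<close>
    have "alphahat * (1 / (r - 1 + \<alpha>)) = 1 / r" "1 - alphahat = (1 / r) * (1 - \<alpha>)"
      using \<open>1 < r\<close> alpha by (auto simp: alphahat divide_simps)
    then have "Ghat = (1 / r) *\<^sub>R (\<alpha> *\<^sub>R P + (r - 1) *\<^sub>R mat 1) + (1 / r) *\<^sub>R (1 - \<alpha>) *\<^sub>R outer 1 t"
      unfolding Ghat Phat by (simp only: scaleR_scaleR)
    also have "\<dots> = (1 / r * (r - 1)) *\<^sub>R mat 1 + (1 / r) *\<^sub>R Gtilde"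
      unfolding Gtilde P_def [symmetric] by (simp only: scaleR_right_distrib scaleR_scaleR ac_simps)
    also have "1 / r * (r - 1) = 1 - 1 / r"
      using \<open>1 < r\<close> by (simp add: field_simps)
    finally show "transpose Ghat *v pihat = pihat"
      using transpose_convex_identity_fixed [OF Gtilde_pihat] by simp
    \<comment> \<open>The bound on \<open>r\<close> enters as
      \<open>\<alpha> * P $ i $ i \<ge> \<alpha> * \<theta> \<ge> 1 - r\<close>.\<close>
    have "0 \<le> \<alpha> * P $ i $ i + (r - 1)" for i
      using mult_left_mono [OF theta_le [of i], of \<alpha>] alpha r by linarith
    then have "stochastic ((1 / (\<alpha> + (r - 1))) *\<^sub>R (\<alpha> *\<^sub>R P + (r - 1) *\<^sub>R mat 1))"
      using P_row_sums P_off_diag alpha \<open>1 < r\<close> by (intro stochastic_shifted) auto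
    then show "stochastic Phat"
      unfolding Phat by (simp only: add.commute [of \<alpha>])
  qed
  show ?thesis
    unfolding Let_def P_def [symmetric] using P_stochastic shifted by blast
qed

end
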